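(* Let $D=(V,A)$ be a connected directed multigraph, $c_l,c_u:A\to\mathbb{Z}$, and $\Delta=(\Delta_C)_C\in\mathbb{Z}^{\mathcal{C}}$, where $\mathcal{C}$ is the set of cycles of $D$ (each with a prescribed direction of traversal). Suppose the set $\mathcal{B}_\Delta(D,c_l,c_u)$ of $\Delta$-bonds is non-empty and that no arc is rigid. Fix a vertex $v_0\in V$. Then the order $\mathcal{P}_\Delta(D,c_l,c_u)$ on $\mathcal{B}_\Delta(D,c_l,c_u)$ defined below is a distributive lattice.
   Context: For a cycle $C$ of the underlying undirected graph of $D$ traversed in its prescribed direction, $C^+$ denotes the arcs traversed forward and $C^-$ those traversed backward; for $x:A\to\mathbb{Z}$, $\delta(C,x)=\sum_{a\in C^+}x(a)-\sum_{a\in C^-}x(a)$. A $\Delta$-bond is a map $x:A\to\mathbb{Z}$ with $c_l(a)\le x(a)\le c_u(a)$ for all $a\in A$ and $\delta(C,x)=\Delta_C$ for all cycles $C$; $\mathcal{B}_\Delta(D,c_l,c_u)$ is the set of $\Delta$-bonds. An arc $a$ is rigid if $x(a)=y(a)$ for all $\Delta$-bonds $x,y$. For $U\subseteq V$, the cut $S[U]$ consists of the forward arcs $S^+[U]$ (from $U$ to $V\setminus U$) and backward arcs $S^-[U]$ (from $V\setminus U$ to $U$); $\mathrm{push}(U,x)$ is the map $y$ with $y(a)=x(a)+1$ for $a\in S^+[U]$, $y(a)=x(a)-1$ for $a\in S^-[U]$, and $y(a)=x(a)$ otherwise. For $\Delta$-bonds $x,y$ define $x\le y$ if $y$ can be reached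 from $x$ by a sequence of pushes at sets $U_i$ with $v_0\notin U_i$ for all $i$, all intermediate maps being $\Delta$-bonds. $\mathcal{P}_\Delta(D,c_l,c_u)$ denotes $\mathcal{B}_\Delta(D,c_l,c_u)$ with this relation.
   Formalization: The vertex set V is assumed finite; for infinite V the claim fails, e.g. on a ray from v_0 with c_l=0, c_u=1, where the all-0 and all-1 bonds have no common lower bound because push sequences are finite. *)

theory Defs
  imports "Graph_Theory.Graph_Theory" "HOL-Algebra.Lattice" "HOL-Library.FuncSet"
begin

text \<open>
  The underlying undirected multigraph is represented by its bidirected double: the arc
  \<open>(a, True)\<close> traverses \<open>a\<close> forward, \<open>(a, False)\<close> traverses it backward.
  Unlike \<^const>\<open>mk_symmetric\<close>, this keeps parallel arcs apart.
\<close>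

definition bidirect :: "('v, 'a) pre_digraph \<Rightarrow> ('v, 'a \<times> bool) pre_digraph" where
  "bidirect D = \<lparr>
     verts = verts D,
     arcs = arcs D \<times> UNIV,
     tail = (\<lambda>(a, fwd). if fwd then tail D a else head D a),
     head = (\<lambda>(a, fwd). if fwd then head D a else tail D a)\<rparr>"

text \<open>
  A cycle of the underlying undirected graph is identified with its arc set.  Distinctness of
  the underlying arcs excludes going back and forth along a single arc; loops, and pairs of
  arcs with the same two ends, are cycles.
\<close>

definition traverses :: "('v, 'a) pre_digraph \<Rightarrow> ('a \<times> bool) list \<Rightarrow> 'a set \<Rightarrow> bool" where
  "traverses D p C \<longleftrightarrow>
     pre_digraph.cycle (bidirect D) p \<and> distinct (map fst p) \<and> C = fst ` set p"

definition cycles :: "('v, 'a) pre_digraph \<Rightarrow> 'a set set" where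
  "cycles D = {C. \<exists>p. traverses D p C}"

definition prescribes_directions ::
    "('v, 'a) pre_digraph \<Rightarrow> ('a set \<Rightarrow> ('a \<times> bool) list) \<Rightarrow> bool" where
  "prescribes_directions D trav \<longleftrightarrow> (\<forall>C \<in> cycles D. traverses D (trav C) C)"

definition fwd_arcs :: "('a set \<Rightarrow> ('a \<times> bool) list) \<Rightarrow> 'a set \<Rightarrow> 'a set" where
  "fwd_arcs trav C = {a. (a, True) \<in> set (trav C)}"

definition bwd_arcs :: "('a set \<Rightarrow> ('a \<times> bool) list) \<Rightarrow> 'a set \<Rightarrow> 'a set" where
  "bwd_arcs trav C = {a. (a, False) \<in> set (trav C)}"

definition circ_diff ::
    "('a set \<Rightarrow> ('a \<times> bool) list) \<Rightarrow> 'a set \<Rightarrow> ('a \<Rightarrow> int) \<Rightarrow> int" where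
  "circ_diff trav C x = (\<Sum>a \<in> fwd_arcs trav C. x a) - (\<Sum>a \<in> bwd_arcs trav C. x a)"

text \<open>
  Bonds are extensional functions, so that two bonds are equal iff they agree on all arcs.
\<close>

definition bonds ::
    "('v, 'a) pre_digraph \<Rightarrow> ('a set \<Rightarrow> ('a \<times> bool) list) \<Rightarrow> ('a set \<Rightarrow> int) \<Rightarrow>
     ('a \<Rightarrow> int) \<Rightarrow> ('a \<Rightarrow> int) \<Rightarrow> ('a \<Rightarrow> int) set" where
  "bonds D trav \<Delta> cl cu =
     {x \<in> arcs D \<rightarrow>\<^sub>E UNIV.
        (\<forall>a \<in> arcs D. cl a \<le> x a \<and> x a \<le> cu a) \<and>
        (\<forall>C \<in> cycles D. circ_diff trav C x = \<Delta> C)}"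

definition rigid ::
    "('v, 'a) pre_digraph \<Rightarrow> ('a set \<Rightarrow> ('a \<times> bool) list) \<Rightarrow> ('a set \<Rightarrow> int) \<Rightarrow>
     ('a \<Rightarrow> int) \<Rightarrow> ('a \<Rightarrow> int) \<Rightarrow> 'a \<Rightarrow> bool" where
  "rigid D trav \<Delta> cl cu a \<longleftrightarrow>
     (\<forall>x \<in> bonds D trav \<Delta> cl cu. \<forall>y \<in> bonds D trav \<Delta> cl cu. x a = y a)"

definition cut_fwd :: "('v, 'a) pre_digraph \<Rightarrow> 'v set \<Rightarrow> 'a set" where
  "cut_fwd D U = {a \<in> arcs D. tail D a \<in> U \<and> head D a \<in> verts D - U}"

definition cut_bwd :: "('v, 'a) pre_digraph \<Rightarrow> 'v set \<Rightarrow> 'a set" where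
  "cut_bwd D U = {a \<in> arcs D. tail D a \<in> verts D - U \<and> head D a \<in> U}"

definition push :: "('v, 'a) pre_digraph \<Rightarrow> 'v set \<Rightarrow> ('a \<Rightarrow> int) \<Rightarrow> 'a \<Rightarrow> int" where
  "push D U x a =
     (if a \<in> cut_fwd D U then x a + 1 else if a \<in> cut_bwd D U then x a - 1 else x a)"

definition push_step ::
    "('v, 'a) pre_digraph \<Rightarrow> ('a set \<Rightarrow> ('a \<times> bool) list) \<Rightarrow> ('a set \<Rightarrow> int) \<Rightarrow>
     ('a \<Rightarrow> int) \<Rightarrow> ('a \<Rightarrow> int) \<Rightarrow> 'v \<Rightarrow> ('a \<Rightarrow> int) \<Rightarrow> ('a \<Rightarrow> int) \<Rightarrow> bool" where
  "push_step D trav \<Delta> cl cu v0 x y \<longleftrightarrow>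
     x \<in> bonds D trav \<Delta> cl cu \<and> y \<in> bonds D trav \<Delta> cl cu \<and>
     (\<exists>U. U \<subseteq> verts D \<and> v0 \<notin> U \<and> y = push D U x)"

definition bond_order ::
    "('v, 'a) pre_digraph \<Rightarrow> ('a set \<Rightarrow> ('a \<times> bool) list) \<Rightarrow> ('a set \<Rightarrow> int) \<Rightarrow>
     ('a \<Rightarrow> int) \<Rightarrow> ('a \<Rightarrow> int) \<Rightarrow> 'v \<Rightarrow> ('a \<Rightarrow> int) gorder" where
  "bond_order D trav \<Delta> cl cu v0 =
     \<lparr>carrier = bonds D trav \<Delta> cl cu, eq = (=), le = (push_step D trav \<Delta> cl cu v0)\<^sup>*\<^sup>*\<rparr>"

definition distributive_lattice :: "'c gorder \<Rightarrow> bool" where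
  "distributive_lattice L \<longleftrightarrow> lattice L \<and>
     (\<forall>x \<in> carrier L. \<forall>y \<in> carrier L. \<forall>z \<in> carrier L.
        x \<sqinter>\<^bsub>L\<^esub> (y \<squnion>\<^bsub>L\<^esub> z) = (x \<sqinter>\<^bsub>L\<^esub> y) \<squnion>\<^bsub>L\<^esub> (x \<sqinter>\<^bsub>L\<^esub> z))"

end

theory Submission
  imports Defs
begin

text \<open>
  Fix a bond \<open>x0\<close>. The difference of two bonds has sum zero along every cycle, hence along every
  closed walk, so it is the coboundary of a unique potential vanishing at \<open>v0\<close>. Bonds thus
  correspond to the integer potentials \<open>p\<close> with \<open>p v0 = 0\<close> whose differences along arcs lie in
  prescribed intervals, and this set is closed under pointwise minimum and maximum. A push at \<open>U\<close>
  adds the indicator of \<open>U\<close> to the potential; conversely, if \<open>p \<le> q\<close>, then pushing at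
  \<open>{v. p v < q v}\<close> gives a feasible potential between \<open>p\<close> and \<open>q\<close>. So the push order is
  the pointwise order of potentials.
\<close>

text \<open>Applied with \<open>fst\<close> it finds a repeated arc of a walk, with
  \<open>head\<close> a repeated vertex, so that closed walks can be cut there.\<close>

lemma not_distinct_map_decomp:
  assumes "\<not> distinct (map f p)"
  obtains q d r e z where "p = q @ d # r @ e # z" "f d = f e"
  using assms
proof (induction p arbitrary: thesis)
  case (Cons x p)
  show ?case
  proof (cases "f x \<in> f ` set p")
    case True
    then obtain e where "e \<in> set p" "f x = f e" by auto
    then obtain r z where "p = r @ e # z" by (meson split_list)
    then show ?thesis using Cons.prems(1)[of "[]" x r e z] \<open>f x = f e\<close> by simp
  next
    case False
    then have "\<not> distinct (map f p)" using Cons.prems(2) by simp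
    then obtain q d r e z where "p = q @ d # r @ e # z" "f d = f e"
      by (rule Cons.IH[rotated])
    then show ?thesis using Cons.prems(1)[of "x # q" d r e z] by simp
  qed
qed simp

section \<open>Sums along walks in the underlying undirected graph\<close>

definition signed_val :: "('a \<Rightarrow> int) \<Rightarrow> 'a \<times> bool \<Rightarrow> int" where
  "signed_val f e = (if snd e then f (fst e) else - f (fst e))"

definition walk_sum :: "('a \<Rightarrow> int) \<Rightarrow> ('a \<times> bool) list \<Rightarrow> int" where
  "walk_sum f p = (\<Sum>e\<leftarrow>p. signed_val f e)"

lemma walk_sum_simps [simp]:
  "walk_sum f [] = 0"
  "walk_sum f (e # p) = signed_val f e + walk_sum f p"
  "walk_sum f (p @ q) = walk_sum f p + walk_sum f q"
  by (simp_all add: walk_sum_def)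

lemma bidirect_simps [simp]:
  "verts (bidirect D) = verts D"
  "arcs (bidirect D) = arcs D \<times> UNIV"
  "tail (bidirect D) (a, s) = (if s then tail D a else head D a)"
  "head (bidirect D) (a, s) = (if s then head D a else tail D a)"
  by (simp_all add: bidirect_def)

lemma wf_digraph_bidirect: "wf_digraph D \<Longrightarrow> wf_digraph (bidirect D)"
  by (auto simp: wf_digraph_def)

lemma signed_val_eq_potential_diff_iff:
  "signed_val f e = \<pi> (tail (bidirect D) e) - \<pi> (head (bidirect D) e) \<longleftrightarrow>
   f (fst e) = \<pi> (tail D (fst e)) - \<pi> (head D (fst e))"
  by (cases e) (auto simp: signed_val_def)

text \<open>Only arcs of the walk are constrained, since the potential of a path need not fit
  \<open>f\<close> elsewhere.\<close>

lemma walk_sum_telescope: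
  assumes "pre_digraph.cas (bidirect D) u p v"
    and "\<And>e. e \<in> set p \<Longrightarrow> f (fst e) = \<pi> (tail D (fst e)) - \<pi> (head D (fst e))"
  shows "walk_sum f p = \<pi> u - \<pi> v"
  using assms
proof (induction p arbitrary: u)
  case Nil
  then show ?case by (simp add: pre_digraph.cas.simps)
next
  case (Cons e p)
  have "signed_val f e = \<pi> (tail (bidirect D) e) - \<pi> (head (bidirect D) e)"
    using Cons.prems(2)[of e] by (simp add: signed_val_eq_potential_diff_iff)
  moreover have "walk_sum f p = \<pi> (head (bidirect D) e) - \<pi> v"
    using Cons by (simp add: pre_digraph.cas.simps)
  ultimately show ?case
    using Cons.prems(1) by (simp add: pre_digraph.cas.simps)
qed

text \<open>Distinct underlying arcs mean that none is met twice or in both directions, so passing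
  from the list to the two sets loses nothing.\<close>

lemma circ_diff_eq_walk_sum:
  assumes "distinct (map fst (trav C))"
  shows "circ_diff trav C x = walk_sum x (trav C)"
proof -
  have "sum x {a. (a, True) \<in> set p} - sum x {a. (a, False) \<in> set p} = walk_sum x p"
    if "distinct (map fst p)" for p :: "('a \<times> bool) list"
    using that
  proof (induction p)
    case (Cons e p)
    obtain a s where e: "e = (a, s)" by fastforce
    have fin: "finite {a. (a, t) \<in> set p}" for t
      by (rule finite_subset[of _ "fst ` set p"]) force+
    have new: "a \<notin> {a. (a, t) \<in> set p}" for t
      using Cons.prems e by force
    have ins: "{b. (b, t) \<in> set (e # p)} =
        (if t = s then insert a {b. (b, t) \<in> set p} else {b. (b, t) \<in> set p})" for t
      using e by auto
    show ?case
      unfolding ins using Cons fin new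
      by (cases s) (auto simp: e signed_val_def)
  qed simp
  then show ?thesis
    using assms by (simp add: circ_diff_def fwd_arcs_def bwd_arcs_def)
qed

section \<open>Vanishing sums over cycles and closed walks\<close>

text \<open>A path never returns to its first vertex, so the potential there can be chosen to fit
  the first arc without disturbing the others.\<close>

lemma (in wf_digraph) apath_potential:
  fixes w :: "'b \<Rightarrow> int"
  assumes "apath u p v"
  shows "\<exists>\<pi>. \<forall>e \<in> set p. w e = \<pi> (tail G e) - \<pi> (head G e)"
  using assms
proof (induction p arbitrary: u)
  case (Cons e p)
  let ?V = "awalk_verts (head G e) p"
  have path: "apath (head G e) p v" and new: "tail G e \<notin> set ?V"
    using Cons.prems by (auto simp: apath_Cons_iff)
  obtain \<pi> where \<pi>: "\<forall>e \<in> set p. w e = \<pi> (tail G e) - \<pi> (head G e)"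
    using Cons.IH[OF path] by blast
  have "head G e \<in> set ?V"
    using path by (auto simp: apath_def intro: hd_in_awalk_verts)
  moreover have "tail G d \<in> set ?V" "head G d \<in> set ?V" if "d \<in> set p" for d
    using that path awalk_verts_arc1 awalk_verts_arc2 by (auto simp: apath_def)
  ultimately have "\<forall>d \<in> set (e # p). w d =
      (\<pi>(tail G e := \<pi> (head G e) + w e)) (tail G d) -
      (\<pi>(tail G e := \<pi> (head G e) + w e)) (head G d)"
    using \<pi> new by force
  then show ?case by blast
qed simp

text \<open>
  Deleting an arc from one traversal leaves a path, on which \<open>f\<close> is the coboundary of a
  potential; telescoping along the other traversal then shows that the deleted arc obeys this
  potential as well.
\<close>

lemma traversal_sum_eq_0:
  assumes wf: "wf_digraph D"
    and p: "traverses D p C" and q: "traverses D q C" and q0: "walk_sum f q = 0"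
  shows "walk_sum f p = 0"
proof -
  interpret B: wf_digraph "bidirect D" using wf by (rule wf_digraph_bidirect)
  obtain u where u: "B.awalk u p u" "distinct (tl (B.awalk_verts u p))" "p \<noteq> []"
    and C: "C = fst ` set p"
    using p by (auto simp: traverses_def B.cycle_def)
  obtain v where v: "B.awalk v q v" and Cq: "C = fst ` set q" and dq: "distinct (map fst q)"
    using q by (auto simp: traverses_def B.cycle_def)
  obtain e r where p_eq: "p = e # r" using u(3) by (cases p) auto
  have "B.apath (head (bidirect D) e) r u"
    using u by (auto simp: p_eq B.apath_def B.awalk_Cons_iff)
  then obtain \<pi> where
    "\<forall>d \<in> set r. signed_val f d = \<pi> (tail (bidirect D) d) - \<pi> (head (bidirect D) d)"
    using B.apath_potential by blast
  then have \<pi>: "\<And>d. d \<in> set r \<Longrightarrow> f (fst d) = \<pi> (tail D (fst d)) - \<pi> (head D (fst d))"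
    by (simp add: signed_val_eq_potential_diff_iff)
  \<comment> \<open>\<open>g\<close> is a coboundary on all arcs; within \<open>C\<close> it can
    differ from \<open>f\<close> only at the deleted arc.\<close>
  define g where "g = (\<lambda>a. \<pi> (tail D a) - \<pi> (head D a))"
  have fg: "f a = g a" if "a \<in> C" "a \<noteq> fst e" for a
    using \<pi> that by (auto simp: C p_eq g_def)
  have "fst e \<in> fst ` set q" using C Cq p_eq by auto
  then obtain d where d: "d \<in> set q" "fst d = fst e" by auto
  then obtain q1 q2 where q_eq: "q = q1 @ d # q2" by (meson split_list)
  have eq: "walk_sum f q' = walk_sum g q'" if "set q' \<subseteq> set q" "fst e \<notin> fst ` set q'" for q'
  proof -
    have "signed_val f c = signed_val g c" if "c \<in> set q'" for c
    proof -
      have "fst c \<in> fst ` set q'" using \<open>c \<in> set q'\<close> by (rule imageI)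
      then have "fst c \<in> C" "fst c \<noteq> fst e"
        using \<open>set q' \<subseteq> set q\<close> \<open>fst e \<notin> fst ` set q'\<close> Cq
        by (blast, metis)
      then show ?thesis using fg by (simp add: signed_val_def)
    qed
    then show ?thesis by (simp add: walk_sum_def cong: map_cong)
  qed
  have "fst e \<notin> fst ` set q1" "fst e \<notin> fst ` set q2"
    using dq d(2) by (auto simp: q_eq)
  then have "walk_sum f q1 = walk_sum g q1" "walk_sum f q2 = walk_sum g q2"
    using eq[of q1] eq[of q2] by (auto simp: q_eq)
  moreover have "walk_sum g q = \<pi> v - \<pi> v"
    using v by (intro walk_sum_telescope[of D]) (auto simp: g_def B.awalk_def)
  \<comment> \<open>\<open>q\<close> uses the deleted arc exactly once and both \<open>f\<close> and
    \<open>g\<close> sum to zero along it, so all other terms cancel.\<close>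
  ultimately have "signed_val f d = signed_val g d"
    using q0 by (simp add: q_eq)
  then have "f (fst e) = g (fst e)"
    using d(2) by (auto simp: signed_val_def split: if_splits)
  then have "\<And>c. c \<in> set p \<Longrightarrow> f (fst c) = \<pi> (tail D (fst c)) - \<pi> (head D (fst c))"
    using \<pi> by (auto simp: p_eq g_def)
  then have "walk_sum f p = \<pi> u - \<pi> u"
    using u(1) by (intro walk_sum_telescope[of D]) (auto simp: B.awalk_def)
  then show ?thesis by simp
qed

text \<open>
  A closed walk that is not a traversal of a cycle either revisits a vertex, repeats an arc in the
  same direction, or uses an arc in both directions; each time it splits into shorter closed walks
  and possibly a cancelling pair.
\<close>

lemma closed_walk_sum_eq_0:
  assumes wf: "wf_digraph D"
    and cyc: "\<And>p C. traverses D p C \<Longrightarrow> walk_sum f p = 0"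
    and closed: "pre_digraph.awalk (bidirect D) u p u"
  shows "walk_sum f p = 0"
proof -
  interpret B: wf_digraph "bidirect D" using wf by (rule wf_digraph_bidirect)
  show ?thesis
    using closed
  proof (induction "length p" arbitrary: u p rule: less_induct)
    case less
    consider "p = []"
      | "p \<noteq> []" "distinct (tl (B.awalk_verts u p))" "distinct (map fst p)"
      | "\<not> distinct (map fst p)"
      | "p \<noteq> []" "\<not> distinct (tl (B.awalk_verts u p))"
      by blast
    then show ?case
    proof cases
      case 1
      then show ?thesis by simp
    next
      case 2
      then have "traverses D p (fst ` set p)"
        using less.prems by (auto simp: traverses_def B.cycle_def)
      then show ?thesis by (rule cyc)
    next
      case 3
      then obtain q a s r t z where p: "p = q @ (a, s) # r @ (a, t) # z"
        by (elim not_distinct_map_decomp) (metis prod.collapse)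
      let ?h = "head (bidirect D)" and ?t = "tail (bidirect D)"
      have q: "B.awalk u q (?t (a, s))" and r: "B.awalk (?h (a, s)) r (?t (a, t))"
        and z: "B.awalk (?h (a, t)) z u" and a: "(a, s) \<in> arcs (bidirect D)"
        using less.prems by (auto simp: p B.awalk_Cons_iff)
      show ?thesis
      \<comment> \<open>With equal directions the part from the first visit up to the second is
        closed and splits off. With opposite directions the two visits cancel, and \<open>r\<close>
        and \<open>q @ z\<close> are closed.\<close>
      proof (cases "s = t")
        case True
        have "B.awalk (?t (a, s)) ((a, s) # r) (?t (a, s))"
          using r a True by (auto simp: B.awalk_Cons_iff)
        then have "walk_sum f ((a, s) # r) = 0"
          by (rule less.hyps[rotated]) (simp add: p)
        moreover have "B.awalk u (q @ (a, s) # z) u"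
          using q z a True by (intro B.awalk_appendI[OF q]) (auto simp: B.awalk_Cons_iff)
        then have "walk_sum f (q @ (a, s) # z) = 0"
          by (rule less.hyps[rotated]) (simp add: p)
        ultimately show ?thesis by (simp add: p True)
      next
        case False
        then have ends: "?t (a, t) = ?h (a, s)" "?h (a, t) = ?t (a, s)" by auto
        have "walk_sum f r = 0"
          using r unfolding ends by (rule less.hyps[rotated]) (simp add: p)
        moreover have "B.awalk u (q @ z) u"
          using q z unfolding ends by (rule B.awalk_appendI)
        then have "walk_sum f (q @ z) = 0"
          by (rule less.hyps[rotated]) (simp add: p)
        ultimately show ?thesis using False by (auto simp: p signed_val_def)
      qed
    next
      case 4
      \<comment> \<open>\<open>tl\<close> drops the start vertex, which reappears as the last head;
        what remains is the list of heads.\<close>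
      have "B.awalk_verts u p = tail (bidirect D) (hd p) # map (head (bidirect D)) p"
        using less.prems 4 B.awalk_verts_conv'[of u p u] by (auto simp: B.awalk_def)
      then have "\<not> distinct (map (head (bidirect D)) p)" using 4 by simp
      then obtain q d r e z where p: "p = q @ d # r @ e # z"
        and de: "head (bidirect D) d = head (bidirect D) e"
        by (elim not_distinct_map_decomp)
      define w where "w = head (bidirect D) e"
      have w: "head (bidirect D) d = w" "head (bidirect D) e = w"
        by (simp_all add: w_def de)
      \<comment> \<open>Cutting after \<open>d\<close> and after \<open>e\<close> leaves two closed
        walks, one lacking \<open>d\<close> and the other \<open>e\<close>, so both are
        shorter.\<close>
      have q: "B.awalk u (q @ [d]) w" and r: "B.awalk w (r @ [e]) w" and z: "B.awalk w z u"
        using less.prems w by (auto simp: p B.awalk_simps)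
      have "walk_sum f (r @ [e]) = 0"
        using r by (rule less.hyps[rotated]) (simp add: p)
      moreover have "walk_sum f ((q @ [d]) @ z) = 0"
        using B.awalk_appendI[OF q z] by (rule less.hyps[rotated]) (simp add: p)
      ultimately show ?thesis by (simp add: p)
    qed
  qed
qed

section \<open>Existence of potentials on connected graphs\<close>

text \<open>Connectedness refers to \<open>mk_symmetric\<close>, which merges parallel arcs.
  Reachability depends only on adjacent pairs, and these all occur in the bidirected double.\<close>

lemma connected_imp_awalk_bidirect:
  assumes wf: "wf_digraph D" and con: "Digraph_Component.connected D"
    and uv: "u \<in> verts D" "v \<in> verts D"
  shows "\<exists>p. pre_digraph.awalk (bidirect D) u p v"
proof -
  interpret B: wf_digraph "bidirect D" using wf by (rule wf_digraph_bidirect)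
  have "arcs_ends (with_proj (mk_symmetric D)) \<subseteq> arcs_ends (bidirect D)"
  proof
    fix x assume "x \<in> arcs_ends (with_proj (mk_symmetric D))"
    then obtain a s where "a \<in> arcs D"
        "x = (tail (bidirect D) (a, s), head (bidirect D) (a, s))"
      by (auto simp: parcs_mk_symmetric split: if_splits) (metis (full_types))+
    then show "x \<in> arcs_ends (bidirect D)"
      using B.in_arcs_imp_in_arcs_ends[of "(a, s)"] by simp
  qed
  moreover have "u \<rightarrow>\<^sup>*\<^bsub>with_proj (mk_symmetric D)\<^esub> v"
    using con uv by (auto simp: connected_def strongly_connected_def)
  ultimately have "u \<rightarrow>\<^sup>*\<^bsub>bidirect D\<^esub> v"
    unfolding reachable_def by (auto intro: rtrancl_on_mono)
  then show ?thesis by (simp add: B.reachable_awalk)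
qed

text \<open>The potential of \<open>v\<close> is the sum of \<open>f\<close> along any walk from
  \<open>v\<close> to \<open>v0\<close>; vanishing sums over closed walks make the choice
  irrelevant.\<close>

lemma potential_exists:
  assumes wf: "wf_digraph D" and con: "Digraph_Component.connected D" and v0: "v0 \<in> verts D"
    and dirs: "prescribes_directions D trav"
    and cyc: "\<And>C. C \<in> cycles D \<Longrightarrow> circ_diff trav C f = 0"
  obtains \<pi> where "\<pi> v0 = 0" "\<And>v. v \<notin> verts D \<Longrightarrow> \<pi> v = 0"
    "\<And>a. a \<in> arcs D \<Longrightarrow> f a = \<pi> (tail D a) - \<pi> (head D a)"
proof -
  interpret wf_digraph D by (rule wf)
  interpret B: wf_digraph "bidirect D" using wf by (rule wf_digraph_bidirect)
  \<comment> \<open>The hypothesis covers only the prescribed traversal of \<open>C\<close>, whereas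
    splitting closed walks can produce any traversal.\<close>
  have "walk_sum f p = 0" if p: "traverses D p C" for p C
  proof -
    have C: "C \<in> cycles D" using p by (auto simp: cycles_def)
    then have t: "traverses D (trav C) C"
      using dirs by (simp add: prescribes_directions_def)
    then have "walk_sum f (trav C) = 0"
      using cyc[OF C] circ_diff_eq_walk_sum[of trav C f] by (simp add: traverses_def)
    with wf p t show ?thesis by (rule traversal_sum_eq_0)
  qed
  then have closed: "walk_sum f p = 0" if "B.awalk u p u" for u p
    using closed_walk_sum_eq_0[OF wf _ that] by blast
  define P where "P v = (SOME p. B.awalk v p v0)" for v
  have P: "B.awalk v (P v) v0" if "v \<in> verts D" for v
    unfolding P_def using connected_imp_awalk_bidirect[OF wf con that v0] by (rule someI_ex)
  define \<pi> where "\<pi> v = (if v \<in> verts D then walk_sum f (P v) else 0)" for v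
  have "\<pi> v0 = 0" using closed[OF P[OF v0]] by (simp add: \<pi>_def)
  moreover have "f a = \<pi> (tail D a) - \<pi> (head D a)" if a: "a \<in> arcs D" for a
  proof -
    have ends: "tail D a \<in> verts D" "head D a \<in> verts D" using a by auto
    \<comment> \<open>The return walk \<open>q\<close> closes both \<open>P (tail D a)\<close> and
      the arc \<open>a\<close> followed by \<open>P (head D a)\<close>; comparing the two zero sums
      gives the claim.\<close>
    obtain q where q: "B.awalk v0 q (tail D a)"
      using connected_imp_awalk_bidirect[OF wf con v0 ends(1)] by blast
    have "B.awalk (tail D a) ((a, True) # P (head D a)) v0"
      using a P[OF ends(2)] by (simp add: B.awalk_Cons_iff)
    then have "walk_sum f (q @ (a, True) # P (head D a)) = 0"
      using closed B.awalk_appendI[OF q] by blast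
    moreover have "walk_sum f (q @ P (tail D a)) = 0"
      using closed B.awalk_appendI[OF q P[OF ends(1)]] by blast
    ultimately show ?thesis using ends by (simp add: \<pi>_def signed_val_def)
  qed
  ultimately show thesis using that[of \<pi>] by (simp add: \<pi>_def)
qed

section \<open>Transfer of the lattice structure\<close>

text \<open>\<open>le\<close> forces \<open>h\<close> to be injective on \<open>P\<close>, and joins
  and meets in \<open>L\<close> are images of those in \<open>P\<close>, so distributivity is
  inherited from the type.\<close>

lemma distributive_lattice_via_order_iso:
  fixes h :: "'p::distrib_lattice \<Rightarrow> 'c" and L :: "'c gorder"
  assumes eq: "eq L = (=)"
    and carr: "carrier L = h ` P"
    and le: "\<And>p q. p \<in> P \<Longrightarrow> q \<in> P \<Longrightarrow> h p \<sqsubseteq>\<^bsub>L\<^esub> h q \<longleftrightarrow> p \<le> q"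
    and inf: "\<And>p q. p \<in> P \<Longrightarrow> q \<in> P \<Longrightarrow> inf_class.inf p q \<in> P"
    and sup: "\<And>p q. p \<in> P \<Longrightarrow> q \<in> P \<Longrightarrow> sup_class.sup p q \<in> P"
  shows "distributive_lattice L"
proof -
  interpret partial_order L
  proof
    show "(.=\<^bsub>L\<^esub>) = (=)" by (rule eq)
  next
    fix x y assume "x \<in> carrier L" "y \<in> carrier L" "x \<sqsubseteq>\<^bsub>L\<^esub> y" "y \<sqsubseteq>\<^bsub>L\<^esub> x"
    then show "x .=\<^bsub>L\<^esub> y" by (auto simp: carr eq le)
  qed (auto simp: carr eq le)
  have least: "least L (h (sup_class.sup p q)) (Upper L {h p, h q})" if "p \<in> P" "q \<in> P" for p q
    using that by (auto simp: least_def Upper_def carr le sup)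
  have greatest: "greatest L (h (inf_class.inf p q)) (Lower L {h p, h q})"
    if "p \<in> P" "q \<in> P" for p q
    using that by (auto simp: greatest_def Lower_def carr le inf)
  have join: "h p \<squnion>\<^bsub>L\<^esub> h q = h (sup_class.sup p q)" if "p \<in> P" "q \<in> P" for p q
    unfolding join_def Lattice.sup_def
    using least[OF that] by (intro some_equality) (auto intro: least_unique)
  have meet: "h p \<sqinter>\<^bsub>L\<^esub> h q = h (inf_class.inf p q)" if "p \<in> P" "q \<in> P" for p q
    unfolding meet_def Lattice.inf_def
    using greatest[OF that] by (intro some_equality) (auto intro: greatest_unique)
  interpret lattice L
  proof
    fix x y assume "x \<in> carrier L" "y \<in> carrier L"
    then show "\<exists>s. least L s (Upper L {x, y})" "\<exists>s. greatest L s (Lower L {x, y})"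
      unfolding carr using least greatest by blast+
  qed
  have "lattice L" ..
  then show ?thesis
    by (auto simp: distributive_lattice_def carr join meet inf sup inf_sup_distrib1)
qed

section \<open>Bonds as potentials\<close>

definition shift :: "('v, 'a) pre_digraph \<Rightarrow> ('a \<Rightarrow> int) \<Rightarrow> ('v \<Rightarrow> int) \<Rightarrow> 'a \<Rightarrow> int" where
  "shift D x p = (\<lambda>a \<in> arcs D. x a + p (tail D a) - p (head D a))"

text \<open>On a connected graph, the normalisations at \<open>v0\<close> and off
  \<open>verts D\<close> make a potential recoverable from its bond.\<close>

definition potentials ::
    "('v, 'a) pre_digraph \<Rightarrow> ('a \<Rightarrow> int) \<Rightarrow> ('a \<Rightarrow> int) \<Rightarrow> 'v \<Rightarrow> ('a \<Rightarrow> int) \<Rightarrow> ('v \<Rightarrow> int) set" where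
  "potentials D cl cu v0 x =
     {p. p v0 = 0 \<and> (\<forall>v. v \<notin> verts D \<longrightarrow> p v = 0) \<and>
         (\<forall>a \<in> arcs D. cl a \<le> shift D x p a \<and> shift D x p a \<le> cu a)}"

text \<open>The added coboundary telescopes to zero around a cycle.\<close>

lemma circ_diff_shift:
  assumes "wf_digraph D" and t: "traverses D (trav C) C"
  shows "circ_diff trav C (shift D x p) = circ_diff trav C x"
proof -
  interpret B: wf_digraph "bidirect D" using assms(1) by (rule wf_digraph_bidirect)
  obtain u where u: "B.awalk u (trav C) u" and d: "distinct (map fst (trav C))"
    using t by (auto simp: traverses_def B.cycle_def)
  define g where "g = (\<lambda>a. p (tail D a) - p (head D a))"
  have "signed_val (shift D x p) e = signed_val x e + signed_val g e" if "e \<in> set (trav C)" for e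
  proof -
    have "fst e \<in> arcs D" using u that by (auto simp: B.awalk_def)
    then show ?thesis by (simp add: signed_val_def shift_def g_def)
  qed
  then have "walk_sum (shift D x p) (trav C) = walk_sum x (trav C) + walk_sum g (trav C)"
    by (simp add: walk_sum_def sum_list_addf cong: map_cong)
  also have "walk_sum g (trav C) = p u - p u"
    using u by (intro walk_sum_telescope[of D]) (auto simp: g_def B.awalk_def)
  finally show ?thesis using d by (simp add: circ_diff_eq_walk_sum)
qed

lemma bonds_eq_shift_image:
  assumes wf: "wf_digraph D" and con: "Digraph_Component.connected D" and v0: "v0 \<in> verts D"
    and dirs: "prescribes_directions D trav" and x: "x \<in> bonds D trav \<Delta> cl cu"
  shows "bonds D trav \<Delta> cl cu = shift D x ` potentials D cl cu v0 x"
proof (intro equalityI subsetI)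
  fix y assume y: "y \<in> bonds D trav \<Delta> cl cu"
  have "circ_diff trav C (\<lambda>a. y a - x a) = 0" if "C \<in> cycles D" for C
  proof -
    have "circ_diff trav C (\<lambda>a. y a - x a) = circ_diff trav C y - circ_diff trav C x"
      by (simp add: circ_diff_def sum_subtractf)
    then show ?thesis using x y that by (simp add: bonds_def)
  qed
  then obtain p where p: "p v0 = 0" "\<And>v. v \<notin> verts D \<Longrightarrow> p v = 0"
      "\<And>a. a \<in> arcs D \<Longrightarrow> y a - x a = p (tail D a) - p (head D a)"
    by (rule potential_exists[OF wf con v0 dirs, of "\<lambda>a. y a - x a"]) blast+
  have "y = shift D x p"
  proof
    fix a show "y a = shift D x p a"
      using p(3)[of a] y by (auto simp: shift_def bonds_def PiE_def extensional_def)
  qed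
  moreover have "p \<in> potentials D cl cu v0 x"
    using p y \<open>y = shift D x p\<close> by (auto simp: potentials_def bonds_def)
  ultimately show "y \<in> shift D x ` potentials D cl cu v0 x" by blast
next
  fix y assume "y \<in> shift D x ` potentials D cl cu v0 x"
  then obtain p where p: "p \<in> potentials D cl cu v0 x" "y = shift D x p" by blast
  have "circ_diff trav C y = \<Delta> C" if "C \<in> cycles D" for C
    using circ_diff_shift[OF wf, of trav C x p] dirs x that
    by (simp add: p prescribes_directions_def bonds_def)
  then show "y \<in> bonds D trav \<Delta> cl cu"
    using p by (auto simp: bonds_def potentials_def shift_def)
qed

text \<open>The coboundary of the indicator of \<open>U\<close> cancels on arcs with both ends on
  one side, so only the cut changes.\<close>

lemma push_shift:
  assumes "wf_digraph D" "U \<subseteq> verts D"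
  shows "push D U (shift D x p) = shift D x (\<lambda>v. p v + (if v \<in> U then 1 else 0))"
proof
  fix a
  interpret wf_digraph D by fact
  show "push D U (shift D x p) a = shift D x (\<lambda>v. p v + (if v \<in> U then 1 else 0)) a"
    by (auto simp: push_def shift_def cut_fwd_def cut_bwd_def)
qed

text \<open>\<open>p - q\<close> does not change along any arc, hence is constant by connectedness,
  and it vanishes at \<open>v0\<close>.\<close>

lemma shift_inj:
  assumes wf: "wf_digraph D" and con: "Digraph_Component.connected D" and v0: "v0 \<in> verts D"
    and p: "p \<in> potentials D cl cu v0 x" and q: "q \<in> potentials D cl cu v0 x"
    and eq: "shift D x p = shift D x q"
  shows "p = q"
proof
  fix v
  interpret B: wf_digraph "bidirect D" using wf by (rule wf_digraph_bidirect)
  have arc: "0 = (p (tail D a) - q (tail D a)) - (p (head D a) - q (head D a))"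
    if "a \<in> arcs D" for a
    using fun_cong[OF eq, of a] that by (simp add: shift_def)
  show "p v = q v"
  proof (cases "v \<in> verts D")
    case True
    then obtain w where w: "B.awalk v0 w v"
      using connected_imp_awalk_bidirect[OF wf con v0] by blast
    have "walk_sum (\<lambda>_. 0) w = (p v0 - q v0) - (p v - q v)"
      using w arc by (intro walk_sum_telescope[of D _ _ _ _ "\<lambda>v. p v - q v"])
        (auto simp: B.awalk_def)
    moreover have "walk_sum (\<lambda>_. 0) w = 0"
      by (induction w) (simp_all add: signed_val_def)
    ultimately show ?thesis using p q by (simp add: potentials_def)
  qed (use p q in \<open>simp add: potentials_def\<close>)
qed

text \<open>Each constraint bounds a difference, \<open>p u - p v \<le> k\<close>. For the minimum,
  the function attaining it at \<open>v\<close> also bounds the minimum at \<open>u\<close>; for the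
  maximum the ends exchange roles.\<close>

lemma potentials_closed_inf_sup:
  assumes "p \<in> potentials D cl cu v0 x" "q \<in> potentials D cl cu v0 x"
  shows "inf_class.inf p q \<in> potentials D cl cu v0 x"
    and "sup_class.sup p q \<in> potentials D cl cu v0 x"
proof -
  have "cl a \<le> shift D x (inf_class.inf p q) a \<and> shift D x (inf_class.inf p q) a \<le> cu a"
    "cl a \<le> shift D x (sup_class.sup p q) a \<and> shift D x (sup_class.sup p q) a \<le> cu a"
    if a: "a \<in> arcs D" for a
  proof -
    have b: "cl a \<le> shift D x p a" "shift D x p a \<le> cu a"
        "cl a \<le> shift D x q a" "shift D x q a \<le> cu a"
      using assms a by (auto simp: potentials_def)
    show "cl a \<le> shift D x (inf_class.inf p q) a \<and> shift D x (inf_class.inf p q) a \<le> cu a"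
      "cl a \<le> shift D x (sup_class.sup p q) a \<and> shift D x (sup_class.sup p q) a \<le> cu a"
      using b a by (simp_all add: shift_def inf_int_def sup_int_def min_def max_def)
  qed
  then show "inf_class.inf p q \<in> potentials D cl cu v0 x"
    "sup_class.sup p q \<in> potentials D cl cu v0 x"
    using assms by (auto simp: potentials_def)
qed

section \<open>The push order as the pointwise order\<close>

text \<open>Pushes only raise potentials. Conversely, pushing wherever \<open>p\<close> is below
  \<open>q\<close> stays below \<open>q\<close> and shrinks the total gap, so iteration reaches
  \<open>q\<close>.\<close>

lemma push_order_iff_potential_le:
  assumes wf: "wf_digraph D" and fin: "finite (verts D)" and con: "Digraph_Component.connected D"
    and v0: "v0 \<in> verts D" and dirs: "prescribes_directions D trav"
    and x: "x \<in> bonds D trav \<Delta> cl cu"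
    and p: "p \<in> potentials D cl cu v0 x" and q: "q \<in> potentials D cl cu v0 x"
  shows "(push_step D trav \<Delta> cl cu v0)\<^sup>*\<^sup>* (shift D x p) (shift D x q) \<longleftrightarrow> p \<le> q"
proof
  let ?P = "potentials D cl cu v0 x"
  assume "(push_step D trav \<Delta> cl cu v0)\<^sup>*\<^sup>* (shift D x p) (shift D x q)"
  then have "\<exists>r \<in> ?P. shift D x q = shift D x r \<and> p \<le> r"
  proof (induction rule: rtranclp_induct)
    case base
    then show ?case using p by blast
  next
    case (step y z)
    then obtain r where r: "r \<in> ?P" "y = shift D x r" "p \<le> r" by blast
    obtain U where U: "U \<subseteq> verts D" "v0 \<notin> U" "z = push D U y" and z: "z \<in> bonds D trav \<Delta> cl cu"
      using step.hyps(2) by (auto simp: push_step_def)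
    let ?r = "\<lambda>v. r v + (if v \<in> U then 1 else 0)"
    have zr: "z = shift D x ?r" using push_shift[OF wf U(1)] U(3) r(2) by simp
    then have "?r \<in> ?P"
      using z r(1) U by (auto simp: potentials_def bonds_def)
    moreover have "p \<le> ?r" using r(3) by (auto simp: le_fun_def intro: order_trans)
    ultimately show ?case using zr by blast
  qed
  then show "p \<le> q" using shift_inj[OF wf con v0 q] by blast
next
  let ?P = "potentials D cl cu v0 x"
  note bonds = bonds_eq_shift_image[OF wf con v0 dirs x]
  assume "p \<le> q"
  with p show "(push_step D trav \<Delta> cl cu v0)\<^sup>*\<^sup>* (shift D x p) (shift D x q)"
  proof (induction "nat (\<Sum>v \<in> verts D. q v - p v)" arbitrary: p rule: less_induct)
    case less
    show ?case
    proof (cases "p = q")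
      case False
      let ?U = "{v \<in> verts D. p v < q v}"
      let ?r = "\<lambda>v. p v + (if v \<in> ?U then 1 else 0)"
      have outside: "p v = q v" if "v \<notin> ?U" for v
        using that less.prems q by (cases "v \<in> verts D")
          (auto simp: potentials_def le_fun_def not_less intro: antisym)
      then have "?U \<noteq> {}" using False by blast
      have le: "p \<le> q" by (rule less.prems)
      have "?r \<in> ?P"
        unfolding potentials_def
      proof (intro CollectI conjI ballI allI impI)
        fix a assume a: "a \<in> arcs D"
        have b: "cl a \<le> shift D x p a" "shift D x p a \<le> cu a"
            "cl a \<le> shift D x q a" "shift D x q a \<le> cu a"
          using less.prems(1) q a by (auto simp: potentials_def)
        \<comment> \<open>If both ends or neither lie in \<open>?U\<close>, the value on
          \<open>a\<close> is unchanged. Otherwise it moves by one towards the value given by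
          \<open>q\<close>; it cannot overshoot, as the end outside \<open>?U\<close> already agrees
          with \<open>q\<close> and the gap at the other is at least one.\<close>
        note ends = outside[of "tail D a"] outside[of "head D a"]
        show "cl a \<le> shift D x ?r a" "shift D x ?r a \<le> cu a"
          using b ends a by (auto simp: shift_def)
      qed (use less.prems(1) q in \<open>auto simp: potentials_def\<close>)
      \<comment> \<open>\<open>v0\<close> is not in \<open>?U\<close> because both potentials vanish
        there.\<close>
      then have "push_step D trav \<Delta> cl cu v0 (shift D x p) (shift D x ?r)"
        unfolding push_step_def bonds
        using less.prems(1) q push_shift[OF wf, of ?U x p]
        by (auto simp: potentials_def intro!: exI[of _ ?U])
      moreover have "(push_step D trav \<Delta> cl cu v0)\<^sup>*\<^sup>* (shift D x ?r) (shift D x q)"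
      proof (rule less.hyps)
        show "?r \<in> ?P" by fact
        show "?r \<le> q" using le by (auto simp: le_fun_def)
        have "(\<Sum>v \<in> verts D. q v - ?r v) < (\<Sum>v \<in> verts D. q v - p v)"
          using \<open>?U \<noteq> {}\<close> by (intro sum_strict_mono_ex1[OF fin]) auto
        moreover have "0 \<le> (\<Sum>v \<in> verts D. q v - ?r v)"
          using le by (intro sum_nonneg) (auto simp: le_fun_def)
        ultimately show "nat (\<Sum>v \<in> verts D. q v - ?r v) < nat (\<Sum>v \<in> verts D. q v - p v)"
          by linarith
      qed
      ultimately show ?thesis by (rule converse_rtranclp_into_rtranclp)
    qed simp
  qed
qed

theorem theorem6:
  fixes D :: "('v, 'a) pre_digraph"
    and trav :: "'a set \<Rightarrow> ('a \<times> bool) list"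
    and \<Delta> :: "'a set \<Rightarrow> int"
    and cl cu :: "'a \<Rightarrow> int"
    and v0 :: 'v
  assumes "wf_digraph D"
    and "finite (verts D)"
    and "Digraph_Component.connected D"
    and "prescribes_directions D trav"
    and "bonds D trav \<Delta> cl cu \<noteq> {}"
    and "\<forall>a \<in> arcs D. \<not> rigid D trav \<Delta> cl cu a"
    and "v0 \<in> verts D"
  shows "distributive_lattice (bond_order D trav \<Delta> cl cu v0)"
proof -
  obtain x where x: "x \<in> bonds D trav \<Delta> cl cu" using assms(5) by blast
  show ?thesis
  \<comment> \<open>The ambient distributive lattice consists of all integer functions on the vertex
    type, ordered pointwise.\<close>
  proof (rule distributive_lattice_via_order_iso)
    show "carrier (bond_order D trav \<Delta> cl cu v0) = shift D x ` potentials D cl cu v0 x"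
      using bonds_eq_shift_image[OF assms(1,3,7,4) x] by (simp add: bond_order_def)
  qed (use push_order_iff_potential_le[OF assms(1-3,7,4) x] in
      \<open>auto simp: bond_order_def intro: potentials_closed_inf_sup\<close>)
qed

end
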